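(* A right loop $(S,\circ)$ is a twisted right gyrogroup if and only if $S$ appears as a twisted gyrotransversal to a subgroup $H$ in a group $G$ inducing the given right loop structure; that is, if and only if there exist a group $G$, a subgroup $H$ of $G$ and an injective map $j:S\to G$ such that $j(S)$ is a twisted gyrotransversal to $H$ in $G$ and $j(x)j(y)\in H\,j(x\circ y)$ for all $x,y\in S$.
   Context: A right loop $(S,\circ)$ with identity $e$ is a set $S$ with a binary operation $\circ$ and a two-sided identity $e$ such that for all $a,b\in S$ the equation $x\circ a=b$ has a unique solution $x\in S$. The left inverse $x'$ of $x$ is the unique element with $x'\circ x=e$. For $y,z\in S$ the right inner mapping $f(y,z):S\to S$ is the bijection defined by $f(y,z)(x)\circ(y\circ z)=(x\circ y)\circ z$ for all $x\in S$. A right loop $(S,\circ)$ is a twisted right gyrogroup if (i) $f(y',y)=I_S$ (the identity map) for all $y\in S$ (consequently $x'$ is the unique two-sided inverse of $x$ for every $x$), and (ii) every right inner mapping $f(y,z)$, $y,z\in S$, is a twisted automorphism, i.e. a bijection $h:S\to S$ with $h(x\circ y)=[h(x')]'\circ h(y)$ for all $x,y\in S$ with $y\neq e$. A right transversal $T$ to a subgroup $H$ of a group $G$ is a subset of $G$ containing the identity $e$ of $G$ and meeting each right coset $Hg$ in exactly one element; the induced operation on $T$ sends $(x,y)$ to the unique element of $T\cap Hxy$. A right transversal $T$ to $H$ in $G$ is a twisted gyrotransversal if (1) $x^{-1}\in T$ for each $x\in T$, and (2) there is an automorphism $\eta$ of $H$ with $\eta^2$ the identity ($\eta$ equal to the identity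 is allowed) such that $\eta(h)^{-1}xh\in T$ for all $x\in T\setminus\{e\}$ and $h\in H$. *)

theory Defs
  imports "HOL-Algebra.Coset"
begin

text \<open>
  Loops are carried by the \<open>monoid\<close> record (carrier, multiplication, identity) of HOL-Algebra;
  no associativity is assumed.
\<close>

locale right_loop =
  fixes S (structure)
  assumes m_closed: "\<lbrakk>x \<in> carrier S; y \<in> carrier S\<rbrakk> \<Longrightarrow> x \<otimes> y \<in> carrier S"
    and one_closed: "\<one> \<in> carrier S"
    and l_one: "x \<in> carrier S \<Longrightarrow> \<one> \<otimes> x = x"
    and r_one: "x \<in> carrier S \<Longrightarrow> x \<otimes> \<one> = x"
    and right_division:
      "\<lbrakk>a \<in> carrier S; b \<in> carrier S\<rbrakk> \<Longrightarrow> \<exists>!x. x \<in> carrier S \<and> x \<otimes> a = b"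

definition left_inv :: "('a, 'b) monoid_scheme \<Rightarrow> 'a \<Rightarrow> 'a" where
  "left_inv S x = (THE y. y \<in> carrier S \<and> y \<otimes>\<^bsub>S\<^esub> x = \<one>\<^bsub>S\<^esub>)"

definition right_inner_map :: "('a, 'b) monoid_scheme \<Rightarrow> 'a \<Rightarrow> 'a \<Rightarrow> 'a \<Rightarrow> 'a" where
  "right_inner_map S y z x =
    (THE u. u \<in> carrier S \<and> u \<otimes>\<^bsub>S\<^esub> (y \<otimes>\<^bsub>S\<^esub> z) = (x \<otimes>\<^bsub>S\<^esub> y) \<otimes>\<^bsub>S\<^esub> z)"

definition twisted_automorphism :: "('a, 'b) monoid_scheme \<Rightarrow> ('a \<Rightarrow> 'a) \<Rightarrow> bool" where
  "twisted_automorphism S h \<longleftrightarrow>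
    bij_betw h (carrier S) (carrier S) \<and>
    (\<forall>x\<in>carrier S. \<forall>y\<in>carrier S. y \<noteq> \<one>\<^bsub>S\<^esub> \<longrightarrow>
      h (x \<otimes>\<^bsub>S\<^esub> y) = left_inv S (h (left_inv S x)) \<otimes>\<^bsub>S\<^esub> h y)"

locale twisted_right_gyrogroup = right_loop +
  assumes inner_inv: "\<lbrakk>y \<in> carrier S; x \<in> carrier S\<rbrakk> \<Longrightarrow> right_inner_map S (left_inv S y) y x = x"
    and inner_twisted:
      "\<lbrakk>y \<in> carrier S; z \<in> carrier S\<rbrakk> \<Longrightarrow> twisted_automorphism S (right_inner_map S y z)"

definition right_transversal :: "('g, 'm) monoid_scheme \<Rightarrow> 'g set \<Rightarrow> 'g set \<Rightarrow> bool" where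
  "right_transversal G H T \<longleftrightarrow>
    T \<subseteq> carrier G \<and> \<one>\<^bsub>G\<^esub> \<in> T \<and> (\<forall>C \<in> rcosets\<^bsub>G\<^esub> H. \<exists>!t. t \<in> T \<inter> C)"

definition twisted_gyrotransversal :: "('g, 'm) monoid_scheme \<Rightarrow> 'g set \<Rightarrow> 'g set \<Rightarrow> bool" where
  "twisted_gyrotransversal G H T \<longleftrightarrow>
    right_transversal G H T \<and>
    (\<forall>x\<in>T. inv\<^bsub>G\<^esub> x \<in> T) \<and>
    (\<exists>\<eta> \<in> iso (G\<lparr>carrier := H\<rparr>) (G\<lparr>carrier := H\<rparr>).
      (\<forall>h\<in>H. \<eta> (\<eta> h) = h) \<and>
      (\<forall>x \<in> T - {\<one>\<^bsub>G\<^esub>}. \<forall>h\<in>H. inv\<^bsub>G\<^esub> (\<eta> h) \<otimes>\<^bsub>G\<^esub> x \<otimes>\<^bsub>G\<^esub> h \<in> T))"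

text \<open>
  The last conjunct says that \<open>j\<close> carries the operation of \<open>S\<close> to the operation that the
  transversal \<open>j ` carrier S\<close> inherits from \<open>G\<close>.
\<close>

definition appears_as_twisted_gyrotransversal ::
    "('a, 'b) monoid_scheme \<Rightarrow> ('g, 'm) monoid_scheme \<Rightarrow> 'g set \<Rightarrow> ('a \<Rightarrow> 'g) \<Rightarrow> bool" where
  "appears_as_twisted_gyrotransversal S G H j \<longleftrightarrow>
    group G \<and> subgroup H G \<and> inj_on j (carrier S) \<and>
    twisted_gyrotransversal G H (j ` carrier S) \<and>
    (\<forall>x\<in>carrier S. \<forall>y\<in>carrier S. j x \<otimes>\<^bsub>G\<^esub> j y \<in> H #>\<^bsub>G\<^esub> j (x \<otimes>\<^bsub>S\<^esub> y))"

end

theory Submission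
  imports Defs
begin

text \<open>
  Both directions rest on the correspondence between a right loop and a right coset space.

  Let \<open>S\<close> sit in \<open>G\<close> as a right transversal to \<open>H\<close>. Then \<open>S\<close> is a copy of the set of right
  cosets of \<open>H\<close>, so \<open>G\<close> acts on \<open>S\<close> from the right by permutations. Right multiplication by \<open>y\<close>
  is the action of \<open>j y\<close>, and the right inner map of \<open>y\<close> and \<open>z\<close> is the action of the element
  \<open>h \<in> H\<close> in \<open>j y j z = h j (y z)\<close>. The twisted invariance of the transversal reads
  \<open>j y h = \<eta>(h) j (y\<cdot>h)\<close> for \<open>y \<noteq> 1\<close>; acting with both sides on \<open>x\<close> gives
  \<open>(x y)\<cdot>h = (x\<cdot>\<eta>(h)) (y\<cdot>h)\<close>, and taking inverses in it gives
  \<open>x\<cdot>\<eta>(h) = (x'\<cdot>h)'\<close>. Hence \<open>H\<close> acts by twisted automorphisms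
  (\<open>act_twisted_automorphism\<close>). The transversal is closed under inverses, so \<open>j y' j y = 1\<close>
  and the inner map of \<open>y'\<close> and \<open>y\<close> is trivial.

  Conversely, let \<open>S\<close> be a twisted right gyrogroup, \<open>H\<close> the set of all its twisted
  automorphisms and \<open>R\<^sub>x\<close> right multiplication by \<open>x\<close>. Conjugation by the inversion \<open>x \<mapsto> x'\<close>
  maps \<open>H\<close> to itself (\<open>twisted_automorphism_conj\<close>), which is a consequence of the right inverse
  property \<open>(x y) y' = x\<close>; it is the involution \<open>\<eta>\<close>. With maps composed from left to right, the
  law of a twisted automorphism is the commutation rule \<open>R\<^sub>x h = \<eta>(h) R\<^bsub>h x\<^esub>\<close> for
  \<open>x \<noteq> 1\<close>, and the definition of the inner maps is \<open>R\<^sub>y R\<^sub>z = f(y,z) R\<^bsub>y z\<^esub>\<close>. These two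
  rules, together with \<open>R\<^sub>x\<^sup>-\<^sup>1 = R\<^bsub>x'\<^esub>\<close>, make the products \<open>h R\<^sub>x\<close> a group of permutations of \<open>S\<close>, in which the maps \<open>R\<^sub>x\<close> form
  a transversal to \<open>H\<close>: the product \<open>h R\<^sub>x\<close> sends \<open>1\<close> to \<open>x\<close>.
\<close>

section \<open>Right loops\<close>

context right_loop
begin

lemma right_cancel:
  assumes "x \<in> carrier S" "y \<in> carrier S" "a \<in> carrier S" "x \<otimes> a = y \<otimes> a"
  shows "x = y"
  using right_division[of a "y \<otimes> a"] assms m_closed by blast

lemma left_inv:
  assumes "x \<in> carrier S"
  shows left_inv_closed: "left_inv S x \<in> carrier S"
    and left_inv_mult: "left_inv S x \<otimes> x = \<one>"
  using theI'[OF right_division[OF assms one_closed]] unfolding left_inv_def by auto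

lemma left_inv_eqI:
  assumes "x \<in> carrier S" "y \<in> carrier S" "y \<otimes> x = \<one>"
  shows "left_inv S x = y"
  using assms right_cancel left_inv_closed left_inv_mult by metis

lemma left_inv_one: "left_inv S \<one> = \<one>"
  by (simp add: left_inv_eqI one_closed l_one)

lemma right_inner_map:
  assumes "x \<in> carrier S" "y \<in> carrier S" "z \<in> carrier S"
  shows right_inner_map_closed: "right_inner_map S y z x \<in> carrier S"
    and right_inner_map_mult: "right_inner_map S y z x \<otimes> (y \<otimes> z) = (x \<otimes> y) \<otimes> z"
proof -
  have "\<exists>!u. u \<in> carrier S \<and> u \<otimes> (y \<otimes> z) = (x \<otimes> y) \<otimes> z"
    using assms by (intro right_division m_closed)
  from theI'[OF this] show "right_inner_map S y z x \<in> carrier S"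
    and "right_inner_map S y z x \<otimes> (y \<otimes> z) = (x \<otimes> y) \<otimes> z"
    unfolding right_inner_map_def by auto
qed

lemma right_inner_map_eqI:
  assumes "x \<in> carrier S" "y \<in> carrier S" "z \<in> carrier S" "u \<in> carrier S"
    "u \<otimes> (y \<otimes> z) = (x \<otimes> y) \<otimes> z"
  shows "right_inner_map S y z x = u"
  using assms right_cancel[of "right_inner_map S y z x" u "y \<otimes> z"]
  by (simp add: right_inner_map m_closed)

lemma twisted_automorphism_cong:
  assumes "twisted_automorphism S h" "\<And>x. x \<in> carrier S \<Longrightarrow> k x = h x"
  shows "twisted_automorphism S k"
proof -
  have "bij_betw k (carrier S) (carrier S)"
    using assms bij_betw_cong[of "carrier S" k h] by (simp add: twisted_automorphism_def)
  then show ?thesis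
    using assms by (simp add: twisted_automorphism_def m_closed left_inv_closed)
qed

end

section \<open>From a transversal to a twisted right gyrogroup\<close>

locale loop_as_transversal = right_loop S + grp: group G
  for S :: "('a, 'b) monoid_scheme" (structure) and G :: "('g, 'm) monoid_scheme" +
  fixes H :: "'g set" and j :: "'a \<Rightarrow> 'g"
  assumes subgroup: "subgroup H G"
    and inj: "inj_on j (carrier S)"
    and transversal: "right_transversal G H (j ` carrier S)"
    and mult_in_coset:
      "\<lbrakk>x \<in> carrier S; y \<in> carrier S\<rbrakk> \<Longrightarrow> j x \<otimes>\<^bsub>G\<^esub> j y \<in> H #>\<^bsub>G\<^esub> j (x \<otimes> y)"
begin

lemma j_closed: "x \<in> carrier S \<Longrightarrow> j x \<in> carrier G"
  using transversal by (auto simp: right_transversal_def)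

lemma H_closed: "h \<in> H \<Longrightarrow> h \<in> carrier G"
  using subgroup by (auto dest: subgroup.subset)

lemma ex1_coset_rep:
  assumes "a \<in> carrier G"
  shows "\<exists>!z. z \<in> carrier S \<and> (\<exists>k\<in>H. a = k \<otimes>\<^bsub>G\<^esub> j z)"
proof -
  have coset: "a = k \<otimes>\<^bsub>G\<^esub> j z \<longleftrightarrow> j z = inv\<^bsub>G\<^esub> k \<otimes>\<^bsub>G\<^esub> a" if "k \<in> H" "z \<in> carrier S" for k z
    using that assms grp.inv_solve_left[of "j z" k a] by (auto simp: H_closed j_closed)
  have rep: "j z \<in> H #>\<^bsub>G\<^esub> a \<longleftrightarrow> (\<exists>k\<in>H. a = k \<otimes>\<^bsub>G\<^esub> j z)" if z: "z \<in> carrier S" for z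
  proof
    assume "j z \<in> H #>\<^bsub>G\<^esub> a"
    then obtain h where "h \<in> H" "j z = h \<otimes>\<^bsub>G\<^esub> a"
      by (auto simp: r_coset_def)
    then show "\<exists>k\<in>H. a = k \<otimes>\<^bsub>G\<^esub> j z"
      using coset[of "inv\<^bsub>G\<^esub> h" z] z subgroup.m_inv_closed[OF subgroup]
      by (intro bexI[of _ "inv\<^bsub>G\<^esub> h"]) (auto simp: H_closed)
  next
    assume "\<exists>k\<in>H. a = k \<otimes>\<^bsub>G\<^esub> j z"
    then show "j z \<in> H #>\<^bsub>G\<^esub> a"
      using coset z subgroup.m_inv_closed[OF subgroup] by (auto simp: r_coset_def)
  qed
  have "H #>\<^bsub>G\<^esub> a \<in> rcosets\<^bsub>G\<^esub> H"
    using assms by (auto simp: RCOSETS_def)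
  then have "\<exists>!t. t \<in> j ` carrier S \<inter> (H #>\<^bsub>G\<^esub> a)"
    using transversal by (simp add: right_transversal_def)
  then obtain t where "t \<in> j ` carrier S" "t \<in> H #>\<^bsub>G\<^esub> a"
    and t: "\<And>s. \<lbrakk>s \<in> j ` carrier S; s \<in> H #>\<^bsub>G\<^esub> a\<rbrakk> \<Longrightarrow> s = t"
    by (meson IntD1 IntD2 IntI)
  then obtain w where w: "w \<in> carrier S" "j w \<in> H #>\<^bsub>G\<^esub> a" "t = j w"
    by blast
  then have "z = w" if "z \<in> carrier S" "j z \<in> H #>\<^bsub>G\<^esub> a" for z
    using that t[of "j z"] inj by (simp add: inj_on_eq_iff)
  with w(1,2) show ?thesis
    using rep by (intro ex1I[of _ w]) blast+
qed

text \<open>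
  The right action of \<open>G\<close> on the right cosets of \<open>H\<close>, transported to \<open>S\<close>: the coset of \<open>j x\<close> is
  sent by \<open>a\<close> to the coset of \<open>j x a\<close>.
\<close>

definition act :: "'g \<Rightarrow> 'a \<Rightarrow> 'a" where
  "act a x = (THE z. z \<in> carrier S \<and> (\<exists>k\<in>H. j x \<otimes>\<^bsub>G\<^esub> a = k \<otimes>\<^bsub>G\<^esub> j z))"

lemma act_closed: "\<lbrakk>a \<in> carrier G; x \<in> carrier S\<rbrakk> \<Longrightarrow> act a x \<in> carrier S"
  and act_coset:
    "\<lbrakk>a \<in> carrier G; x \<in> carrier S\<rbrakk> \<Longrightarrow> \<exists>k\<in>H. j x \<otimes>\<^bsub>G\<^esub> a = k \<otimes>\<^bsub>G\<^esub> j (act a x)"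
  using theI'[OF ex1_coset_rep[of "j x \<otimes>\<^bsub>G\<^esub> a"]]
  unfolding act_def by (auto simp: j_closed)

lemma act_eqI:
  assumes "a \<in> carrier G" "x \<in> carrier S" "z \<in> carrier S" "k \<in> H"
    "j x \<otimes>\<^bsub>G\<^esub> a = k \<otimes>\<^bsub>G\<^esub> j z"
  shows "act a x = z"
  unfolding act_def
  by (rule the1_equality[OF ex1_coset_rep]) (use assms in \<open>auto simp: j_closed H_closed\<close>)

lemma act_mult:
  assumes "a \<in> carrier G" "b \<in> carrier G" "x \<in> carrier S"
  shows "act (a \<otimes>\<^bsub>G\<^esub> b) x = act b (act a x)"
proof -
  obtain k where k: "k \<in> H" "j x \<otimes>\<^bsub>G\<^esub> a = k \<otimes>\<^bsub>G\<^esub> j (act a x)"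
    using act_coset assms by blast
  obtain l where l: "l \<in> H" "j (act a x) \<otimes>\<^bsub>G\<^esub> b = l \<otimes>\<^bsub>G\<^esub> j (act b (act a x))"
    using act_coset act_closed assms by blast
  have "j x \<otimes>\<^bsub>G\<^esub> (a \<otimes>\<^bsub>G\<^esub> b) = (k \<otimes>\<^bsub>G\<^esub> j (act a x)) \<otimes>\<^bsub>G\<^esub> b"
    using assms k by (simp add: j_closed flip: grp.m_assoc)
  also have "\<dots> = (k \<otimes>\<^bsub>G\<^esub> l) \<otimes>\<^bsub>G\<^esub> j (act b (act a x))"
    using assms k l by (simp add: j_closed act_closed H_closed grp.m_assoc)
  finally show ?thesis
    using assms k l subgroup.m_closed[OF subgroup]
    by (intro act_eqI) (auto simp: act_closed)
qed

lemma j_one: "j \<one> = \<one>\<^bsub>G\<^esub>"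
proof -
  obtain e where e: "e \<in> carrier S" "j e = \<one>\<^bsub>G\<^esub>"
    using transversal by (auto simp: right_transversal_def)
  obtain h where h: "h \<in> H" "j \<one> \<otimes>\<^bsub>G\<^esub> j \<one> = h \<otimes>\<^bsub>G\<^esub> j \<one>"
    using mult_in_coset[of \<one> \<one>] by (auto simp: one_closed l_one r_coset_def)
  then have "j \<one> = h \<otimes>\<^bsub>G\<^esub> j e"
    by (simp add: e j_closed one_closed H_closed)
  moreover have "j \<one> = \<one>\<^bsub>G\<^esub> \<otimes>\<^bsub>G\<^esub> j \<one>"
    by (simp add: j_closed one_closed)
  ultimately have "e = \<one>"
    using ex1_coset_rep[of "j \<one>"] h e subgroup.one_closed[OF subgroup]
    by (metis j_closed one_closed)
  with e show ?thesis by simp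
qed

lemma act_one: "x \<in> carrier S \<Longrightarrow> act \<one>\<^bsub>G\<^esub> x = x"
  using subgroup.one_closed[OF subgroup] by (intro act_eqI[of _ _ _ "\<one>\<^bsub>G\<^esub>"]) (auto simp: j_closed)

lemma act_j: "\<lbrakk>x \<in> carrier S; y \<in> carrier S\<rbrakk> \<Longrightarrow> act (j y) x = x \<otimes> y"
  using mult_in_coset[of x y] by (auto simp: r_coset_def j_closed m_closed intro: act_eqI)

lemma act_fixes_one: "h \<in> H \<Longrightarrow> act h \<one> = \<one>"
  by (intro act_eqI[of _ _ _ h]) (auto simp: H_closed one_closed j_one)

lemma act_bij:
  assumes "a \<in> carrier G"
  shows "bij_betw (act a) (carrier S) (carrier S)"
proof (rule bij_betw_byWitness)
  show "\<forall>x\<in>carrier S. act (inv\<^bsub>G\<^esub> a) (act a x) = x"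
    "\<forall>x\<in>carrier S. act a (act (inv\<^bsub>G\<^esub> a) x) = x"
    using assms by (auto simp: act_one simp flip: act_mult)
qed (use assms act_closed in auto)

text \<open>
  The right loop measures its failure of associativity inside \<open>H\<close>: by \<open>act_mult\<close> the
  permutation \<open>R\<^sub>y\<close> followed by \<open>R\<^sub>z\<close> is the action of \<open>j y j z = h j (y z)\<close>.
\<close>

lemma right_inner_map_eq_act:
  assumes "y \<in> carrier S" "z \<in> carrier S" "h \<in> H"
    and h: "j y \<otimes>\<^bsub>G\<^esub> j z = h \<otimes>\<^bsub>G\<^esub> j (y \<otimes> z)"
    and "x \<in> carrier S"
  shows "right_inner_map S y z x = act h x"
proof (rule right_inner_map_eqI)
  have "act h x \<otimes> (y \<otimes> z) = act (h \<otimes>\<^bsub>G\<^esub> j (y \<otimes> z)) x"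
    using assms by (simp add: act_mult act_j m_closed act_closed H_closed j_closed)
  also have "\<dots> = (x \<otimes> y) \<otimes> z"
    using assms by (simp add: act_mult act_j m_closed act_closed j_closed flip: h)
  finally show "act h x \<otimes> (y \<otimes> z) = (x \<otimes> y) \<otimes> z" .
qed (use assms act_closed H_closed in auto)

lemma j_left_inv:
  assumes "x \<in> carrier S" "inv\<^bsub>G\<^esub> (j x) \<in> j ` carrier S"
  shows "j (left_inv S x) = inv\<^bsub>G\<^esub> (j x)"
proof -
  obtain w where w: "w \<in> carrier S" "j w = inv\<^bsub>G\<^esub> (j x)"
    using assms(2) by force
  have "act (j x) w = \<one>"
    using w assms subgroup.one_closed[OF subgroup]
    by (intro act_eqI[of _ _ _ "\<one>\<^bsub>G\<^esub>"]) (auto simp: j_closed one_closed j_one)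
  then have "left_inv S x = w"
    using w assms by (intro left_inv_eqI) (auto simp: act_j)
  with w show ?thesis by simp
qed

text \<open>
  The identity \<open>j y h = \<eta>(h) j (y\<cdot>h)\<close> is used twice. Acting with it on \<open>x\<close> gives the law
  with \<open>x\<cdot>\<eta>(h)\<close> as first factor; inverting its instance at \<open>x'\<close> identifies that factor
  as \<open>(x'\<cdot>h)'\<close>.
\<close>

lemma act_twisted_automorphism:
  assumes inv_closed: "\<And>x. x \<in> carrier S \<Longrightarrow> inv\<^bsub>G\<^esub> (j x) \<in> j ` carrier S"
    and \<eta>: "\<And>h. h \<in> H \<Longrightarrow> \<eta> h \<in> H"
    and twist: "\<And>y h. \<lbrakk>y \<in> carrier S; y \<noteq> \<one>; h \<in> H\<rbrakk> \<Longrightarrow>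
      inv\<^bsub>G\<^esub> (\<eta> h) \<otimes>\<^bsub>G\<^esub> j y \<otimes>\<^bsub>G\<^esub> h \<in> j ` carrier S"
    and "h \<in> H"
  shows "twisted_automorphism S (act h)"
proof -
  have hG: "h \<in> carrier G" "\<eta> h \<in> carrier G"
    using assms H_closed by auto
  have commute: "j y \<otimes>\<^bsub>G\<^esub> h = \<eta> h \<otimes>\<^bsub>G\<^esub> j (act h y)" if y: "y \<in> carrier S" "y \<noteq> \<one>" for y
  proof -
    obtain z where z: "z \<in> carrier S" "j z = inv\<^bsub>G\<^esub> (\<eta> h) \<otimes>\<^bsub>G\<^esub> j y \<otimes>\<^bsub>G\<^esub> h"
      using twist[OF y \<open>h \<in> H\<close>] by force
    then have eq: "j y \<otimes>\<^bsub>G\<^esub> h = \<eta> h \<otimes>\<^bsub>G\<^esub> j z"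
      using y hG by (simp add: j_closed grp.m_assoc grp.inv_solve_left)
    then have "act h y = z"
      using y z \<eta> \<open>h \<in> H\<close> hG by (intro act_eqI) auto
    with eq show ?thesis by simp
  qed
  have factor: "left_inv S (act h (left_inv S x)) = act (\<eta> h) x" if x: "x \<in> carrier S" for x
  proof (cases "x = \<one>")
    case True
    then show ?thesis
      using \<open>h \<in> H\<close> \<eta> by (simp add: left_inv_one act_fixes_one)
  next
    case False
    define w where "w = left_inv S x"
    have w: "w \<in> carrier S" "w \<otimes> x = \<one>" "j w = inv\<^bsub>G\<^esub> (j x)"
      using x inv_closed by (auto simp: w_def left_inv j_left_inv)
    with False x have "w \<noteq> \<one>"
      by (auto simp: l_one)
    then have "inv\<^bsub>G\<^esub> (j w \<otimes>\<^bsub>G\<^esub> h) = inv\<^bsub>G\<^esub> (\<eta> h \<otimes>\<^bsub>G\<^esub> j (act h w))"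
      using w(1) by (simp add: commute)
    then have "inv\<^bsub>G\<^esub> h \<otimes>\<^bsub>G\<^esub> j x = j (left_inv S (act h w)) \<otimes>\<^bsub>G\<^esub> inv\<^bsub>G\<^esub> (\<eta> h)"
      using w x hG inv_closed
      by (simp add: grp.inv_mult_group j_closed act_closed j_left_inv)
    then have "j x = (h \<otimes>\<^bsub>G\<^esub> j (left_inv S (act h w))) \<otimes>\<^bsub>G\<^esub> inv\<^bsub>G\<^esub> (\<eta> h)"
      using w(1) x hG by (simp add: grp.inv_solve_left' grp.m_assoc j_closed act_closed left_inv_closed)
    then have "j x \<otimes>\<^bsub>G\<^esub> \<eta> h = h \<otimes>\<^bsub>G\<^esub> j (left_inv S (act h w))"
      using w(1) x hG by (simp add: grp.inv_solve_right j_closed act_closed left_inv_closed)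
    then have "act (\<eta> h) x = left_inv S (act h w)"
      using w x hG \<open>h \<in> H\<close> by (intro act_eqI) (auto simp: left_inv_closed act_closed)
    then show ?thesis by (simp add: w_def)
  qed
  have "act h (x \<otimes> y) = left_inv S (act h (left_inv S x)) \<otimes> act h y"
    if xy: "x \<in> carrier S" "y \<in> carrier S" "y \<noteq> \<one>" for x y
  proof -
    have "act h (x \<otimes> y) = act (j y \<otimes>\<^bsub>G\<^esub> h) x"
      using xy hG by (simp add: act_mult act_j j_closed)
    also have "\<dots> = act (\<eta> h) x \<otimes> act h y"
      using xy hG by (simp add: commute act_mult act_j j_closed act_closed)
    finally show ?thesis
      using xy by (simp add: factor)
  qed
  then show ?thesis
    using act_bij hG by (auto simp: twisted_automorphism_def)
qed

end

lemma twisted_right_gyrogroup_if_appears: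
  assumes "right_loop S" and app: "appears_as_twisted_gyrotransversal S G H j"
  shows "twisted_right_gyrogroup S"
proof -
  have T: "group G" "subgroup H G" "inj_on j (carrier S)" "right_transversal G H (j ` carrier S)"
    "\<forall>x\<in>carrier S. \<forall>y\<in>carrier S. j x \<otimes>\<^bsub>G\<^esub> j y \<in> H #>\<^bsub>G\<^esub> j (x \<otimes>\<^bsub>S\<^esub> y)"
    and inv_closed: "\<And>x. x \<in> carrier S \<Longrightarrow> inv\<^bsub>G\<^esub> (j x) \<in> j ` carrier S"
    using app by (auto simp: appears_as_twisted_gyrotransversal_def twisted_gyrotransversal_def)
  interpret loop_as_transversal S G H j
    using assms(1) T by (simp add: loop_as_transversal_def loop_as_transversal_axioms_def)
  obtain \<eta> where \<eta>: "\<eta> \<in> iso (G\<lparr>carrier := H\<rparr>) (G\<lparr>carrier := H\<rparr>)"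
    and twist: "\<forall>t \<in> j ` carrier S - {\<one>\<^bsub>G\<^esub>}. \<forall>h\<in>H.
      inv\<^bsub>G\<^esub> (\<eta> h) \<otimes>\<^bsub>G\<^esub> t \<otimes>\<^bsub>G\<^esub> h \<in> j ` carrier S"
    using app by (auto simp: appears_as_twisted_gyrotransversal_def twisted_gyrotransversal_def)
  have \<eta>_closed: "\<eta> h \<in> H" if "h \<in> H" for h
    using \<eta> that by (auto simp: iso_def hom_def)
  have "j y \<noteq> \<one>\<^bsub>G\<^esub>" if "y \<in> carrier S" "y \<noteq> \<one>\<^bsub>S\<^esub>" for y
    using that inj one_closed by (auto simp: inj_on_def simp flip: j_one)
  then have H_twisted: "twisted_automorphism S (act h)" if "h \<in> H" for h
    using that inv_closed \<eta>_closed twist by (intro act_twisted_automorphism[of \<eta>]) auto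
  show ?thesis
  proof unfold_locales
    fix y x assume xy: "y \<in> carrier S" "x \<in> carrier S"
    have "right_inner_map S (left_inv S y) y x = act \<one>\<^bsub>G\<^esub> x"
      using xy inv_closed subgroup.one_closed[OF subgroup]
      by (intro right_inner_map_eq_act) (auto simp: left_inv j_left_inv j_closed j_one)
    then show "right_inner_map S (left_inv S y) y x = x"
      using xy by (simp add: act_one)
  next
    fix y z assume yz: "y \<in> carrier S" "z \<in> carrier S"
    obtain h where "h \<in> H" "j y \<otimes>\<^bsub>G\<^esub> j z = h \<otimes>\<^bsub>G\<^esub> j (y \<otimes>\<^bsub>S\<^esub> z)"
      using mult_in_coset[OF yz] by (auto simp: r_coset_def)
    then show "twisted_automorphism S (right_inner_map S y z)"
      using H_twisted yz right_inner_map_eq_act by (blast intro: twisted_automorphism_cong)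
  qed
qed

section \<open>Twisted automorphisms of a twisted right gyrogroup\<close>

context twisted_right_gyrogroup
begin

lemma right_inverse_property':
  assumes "x \<in> carrier S" "y \<in> carrier S"
  shows "(x \<otimes> left_inv S y) \<otimes> y = x"
  using right_inner_map_mult[of x "left_inv S y" y] assms
  by (simp add: inner_inv left_inv r_one)

lemma left_inv_left_inv:
  assumes "x \<in> carrier S"
  shows "left_inv S (left_inv S x) = x"
  using right_inverse_property'[of "left_inv S (left_inv S x)" x] assms
  by (simp add: left_inv l_one)

lemma right_inverse_property:
  assumes "x \<in> carrier S" "y \<in> carrier S"
  shows "(x \<otimes> y) \<otimes> left_inv S y = x"
  using right_inverse_property'[of x "left_inv S y"] assms
  by (simp add: left_inv_closed left_inv_left_inv)

lemma left_inv_eq_one_iff: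
  assumes "x \<in> carrier S"
  shows "left_inv S x = \<one> \<longleftrightarrow> x = \<one>"
  using left_inv_left_inv[OF assms] by (auto simp: left_inv_one)

abbreviation conj_left_inv :: "('a \<Rightarrow> 'a) \<Rightarrow> 'a \<Rightarrow> 'a" where
  "conj_left_inv h \<equiv> (\<lambda>x\<in>carrier S. left_inv S (h (left_inv S x)))"

lemma twisted_bij: "twisted_automorphism S h \<Longrightarrow> bij_betw h (carrier S) (carrier S)"
  by (simp add: twisted_automorphism_def)

lemma twisted_closed: "\<lbrakk>twisted_automorphism S h; x \<in> carrier S\<rbrakk> \<Longrightarrow> h x \<in> carrier S"
  by (auto dest: twisted_bij bij_betwE)

lemma twisted_mult:
  assumes "twisted_automorphism S h" "x \<in> carrier S" "y \<in> carrier S" "y \<noteq> \<one>"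
  shows "h (x \<otimes> y) = conj_left_inv h x \<otimes> h y"
  using assms by (simp add: twisted_automorphism_def)

lemma twisted_one:
  assumes "twisted_automorphism S h"
  shows "h \<one> = \<one>"
proof (cases "carrier S = {\<one>}")
  case True
  then show ?thesis
    using twisted_closed[OF assms one_closed] by auto
next
  case False
  then obtain y where y: "y \<in> carrier S" "y \<noteq> \<one>"
    using one_closed by blast
  \<comment> \<open>apply the law to \<open>y' y = 1\<close>\<close>
  then have "h \<one> = left_inv S (h (left_inv S (left_inv S y))) \<otimes> h y"
    using twisted_mult[OF assms, of "left_inv S y" y] by (simp add: left_inv)
  then show ?thesis
    using y twisted_closed[OF assms] by (simp add: left_inv_left_inv left_inv)
qed

lemma twisted_eq_one_iff:
  assumes "twisted_automorphism S h" "x \<in> carrier S"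
  shows "h x = \<one> \<longleftrightarrow> x = \<one>"
  using bij_betw_imp_inj_on[OF twisted_bij] twisted_one assms one_closed
  by (metis inj_on_eq_iff)

lemma conj_conj:
  assumes "twisted_automorphism S h" "x \<in> carrier S"
  shows "conj_left_inv (conj_left_inv h) x = h x"
  using assms by (simp add: left_inv_closed left_inv_left_inv twisted_closed)

lemma conj_bij:
  assumes "bij_betw h (carrier S) (carrier S)"
  shows "bij_betw (conj_left_inv h) (carrier S) (carrier S)"
proof -
  have i: "bij_betw (left_inv S) (carrier S) (carrier S)"
    by (rule bij_betw_byWitness[of _ "left_inv S"]) (auto simp: left_inv_closed left_inv_left_inv)
  have "bij_betw (left_inv S \<circ> (h \<circ> left_inv S)) (carrier S) (carrier S)"
    by (intro bij_betw_trans[OF _ i] bij_betw_trans[OF i] assms)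
  then show ?thesis
    by (rule iffD1[OF bij_betw_cong, rotated]) simp
qed

text \<open>
  Put \<open>z = x y\<close>, so that \<open>x = z y'\<close>. The law for \<open>h\<close> at \<open>z y'\<close> gives
  \<open>h x = \<eta>(h)(z) h(y')\<close>, and cancelling \<open>h(y')\<close> from the right turns this into
  \<open>\<eta>(h)(x y) = h(x) \<eta>(h)(y)\<close>, where \<open>h\<close> is the conjugate of \<open>\<eta>(h)\<close>.
\<close>

lemma twisted_automorphism_conj:
  assumes h: "twisted_automorphism S h"
  shows "twisted_automorphism S (conj_left_inv h)"
  unfolding twisted_automorphism_def
proof (intro conjI ballI impI)
  show "bij_betw (conj_left_inv h) (carrier S) (carrier S)"
    using h by (intro conj_bij twisted_bij)
next
  fix x y assume xy: "x \<in> carrier S" "y \<in> carrier S" "y \<noteq> \<one>"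
  define z where "z = x \<otimes> y"
  have z: "z \<in> carrier S" "z \<otimes> left_inv S y = x"
    using xy by (auto simp: z_def m_closed right_inverse_property)
  have hx: "h x = conj_left_inv h z \<otimes> h (left_inv S y)"
    using twisted_mult[OF h z(1), of "left_inv S y"] xy z
    by (simp add: left_inv_closed left_inv_eq_one_iff)
  have "conj_left_inv h z = h x \<otimes> left_inv S (h (left_inv S y))"
    unfolding hx using xy z h
    by (subst right_inverse_property) (auto simp: left_inv_closed twisted_closed)
  then show "conj_left_inv h (x \<otimes> y) =
      left_inv S (conj_left_inv h (left_inv S x)) \<otimes> conj_left_inv h y"
    using xy h by (simp add: z_def left_inv_closed left_inv_left_inv twisted_closed)
qed

lemma conj_compose:
  assumes "twisted_automorphism S h" "twisted_automorphism S k"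
  shows "conj_left_inv (compose (carrier S) k h) =
    compose (carrier S) (conj_left_inv k) (conj_left_inv h)"
  using assms
  by (auto simp: compose_def fun_eq_iff left_inv_closed left_inv_left_inv twisted_closed)

lemma twisted_automorphism_compose:
  assumes h: "twisted_automorphism S h" and k: "twisted_automorphism S k"
  shows "twisted_automorphism S (compose (carrier S) k h)"
  unfolding twisted_automorphism_def
proof (intro conjI ballI impI)
  show "bij_betw (compose (carrier S) k h) (carrier S) (carrier S)"
    using h k by (intro bij_betw_compose) (auto intro: twisted_bij)
next
  fix x y assume xy: "x \<in> carrier S" "y \<in> carrier S" "y \<noteq> \<one>"
  have "k (h (x \<otimes> y)) = conj_left_inv k (conj_left_inv h x) \<otimes> k (h y)"
    unfolding twisted_mult[OF h xy] using xy h k twisted_closed[OF twisted_automorphism_conj[OF h]]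
    by (intro twisted_mult) (auto simp: twisted_closed twisted_eq_one_iff)
  then show "compose (carrier S) k h (x \<otimes> y) =
      left_inv S (compose (carrier S) k h (left_inv S x)) \<otimes> compose (carrier S) k h y"
    using xy h
    by (simp add: compose_eq m_closed left_inv_closed left_inv_left_inv twisted_closed)
qed

lemma twisted_automorphism_inv:
  assumes h: "twisted_automorphism S h"
  shows "twisted_automorphism S (inv_into (carrier S) h)"
proof -
  define g where "g = inv_into (carrier S) h"
  have bij: "bij_betw g (carrier S) (carrier S)"
    unfolding g_def by (intro bij_betw_inv_into twisted_bij h)
  then have g_closed: "g x \<in> carrier S" if "x \<in> carrier S" for x
    using that by (rule bij_betw_apply)
  have gh: "g (h x) = x" if "x \<in> carrier S" for x
    using that h by (simp add: g_def bij_betw_inv_into_left[OF twisted_bij])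
  have hg: "h (g x) = x" if "x \<in> carrier S" for x
    using that h by (simp add: g_def bij_betw_inv_into_right[OF twisted_bij])
  have "g (u \<otimes> v) = left_inv S (g (left_inv S u)) \<otimes> g v"
    if uv: "u \<in> carrier S" "v \<in> carrier S" "v \<noteq> \<one>" for u v
  proof -
    \<comment> \<open>conjugation respects inverses, so this is the point that \<open>conj_left_inv h\<close> sends to \<open>u\<close>\<close>
    define x where "x = left_inv S (g (left_inv S u))"
    have x: "x \<in> carrier S"
      using uv by (simp add: x_def left_inv_closed g_closed)
    have hx: "conj_left_inv h x = u"
      using uv x by (simp add: x_def left_inv_closed left_inv_left_inv g_closed hg)
    have "g v \<noteq> \<one>"
      using uv hg[of v] twisted_one[OF h] by metis
    then have "h (x \<otimes> g v) = u \<otimes> v"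
      using twisted_mult[OF h x g_closed[OF uv(2)]] hg[OF uv(2)] hx by simp
    then have "g (u \<otimes> v) = x \<otimes> g v"
      using gh[of "x \<otimes> g v"] x g_closed[OF uv(2)] m_closed by simp
    then show ?thesis
      by (simp add: x_def)
  qed
  with bij show ?thesis
    by (simp add: twisted_automorphism_def g_def)
qed

section \<open>The group of twisted automorphisms and right multiplications\<close>

definition twisted_maps :: "('a \<Rightarrow> 'a) set" where
  "twisted_maps = {h \<in> extensional (carrier S). twisted_automorphism S h}"

definition rmult :: "'a \<Rightarrow> 'a \<Rightarrow> 'a" where
  "rmult x = (\<lambda>u\<in>carrier S. u \<otimes> x)"

text \<open>
  Maps act from the right, so the product of \<open>f\<close> and \<open>g\<close> is \<open>f\<close> followed by \<open>g\<close>; the maps are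
  extensional so that they are determined by their values on \<open>S\<close>.
\<close>

definition twisted_group :: "('a \<Rightarrow> 'a) monoid" where
  "twisted_group = \<lparr>carrier = {compose (carrier S) (rmult x) h | x h. x \<in> carrier S \<and> h \<in> twisted_maps},
    mult = (\<lambda>f g. compose (carrier S) g f), one = (\<lambda>u\<in>carrier S. u)\<rparr>"

lemma twisted_mapsD:
  assumes "h \<in> twisted_maps"
  shows "twisted_automorphism S h" "h \<in> extensional (carrier S)"
    "u \<in> carrier S \<Longrightarrow> h u \<in> carrier S"
  using assms by (auto simp: twisted_maps_def twisted_closed)

lemma conj_in_twisted_maps: "h \<in> twisted_maps \<Longrightarrow> conj_left_inv h \<in> twisted_maps"
  using twisted_automorphism_conj by (auto simp: twisted_maps_def)

lemma conj_conj_eq: "h \<in> twisted_maps \<Longrightarrow> conj_left_inv (conj_left_inv h) = h"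
  using conj_conj twisted_mapsD
  by (intro extensionalityI[where A = "carrier S"]) auto

lemma id_in_twisted_maps: "(\<lambda>u\<in>carrier S. u) \<in> twisted_maps"
proof -
  have "twisted_automorphism S (\<lambda>u. u)"
    by (simp add: twisted_automorphism_def left_inv_left_inv bij_betw_def)
  then show ?thesis
    unfolding twisted_maps_def by (auto intro: twisted_automorphism_cong)
qed

lemma rmult_one: "rmult \<one> = (\<lambda>u\<in>carrier S. u)"
  by (auto simp: rmult_def r_one)

lemma compose_in_twisted_maps:
  "\<lbrakk>h \<in> twisted_maps; k \<in> twisted_maps\<rbrakk> \<Longrightarrow> compose (carrier S) k h \<in> twisted_maps"
  using twisted_automorphism_compose by (auto simp: twisted_maps_def)

lemma ex_inverse_in_twisted_maps:
  assumes "h \<in> twisted_maps"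
  obtains g where "g \<in> twisted_maps" "\<And>u. u \<in> carrier S \<Longrightarrow> h (g u) = u"
proof
  show "(\<lambda>x\<in>carrier S. inv_into (carrier S) h x) \<in> twisted_maps"
    using twisted_automorphism_inv[of h] assms twisted_automorphism_cong
    by (auto simp: twisted_maps_def)
  show "h ((\<lambda>x\<in>carrier S. inv_into (carrier S) h x) u) = u" if "u \<in> carrier S" for u
    using that assms by (simp add: bij_betw_inv_into_right[OF twisted_bij] twisted_mapsD)
qed

lemma right_inner_map_in_twisted_maps:
  assumes "y \<in> carrier S" "z \<in> carrier S"
  shows "restrict (right_inner_map S y z) (carrier S) \<in> twisted_maps"
  using inner_twisted[OF assms] unfolding twisted_maps_def
  by (auto intro: twisted_automorphism_cong)

lemma twisted_group_carrierD:
  assumes "g \<in> carrier twisted_group"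
  shows "g \<in> extensional (carrier S)"
    and "\<exists>x\<in>carrier S. \<exists>h\<in>twisted_maps. \<forall>u\<in>carrier S. g u = h u \<otimes> x"
proof -
  obtain x h where g: "x \<in> carrier S" "h \<in> twisted_maps" "g = compose (carrier S) (rmult x) h"
    using assms by (auto simp: twisted_group_def)
  then show "g \<in> extensional (carrier S)"
    by simp
  have "g u = h u \<otimes> x" if "u \<in> carrier S" for u
    using g that by (simp add: compose_eq rmult_def twisted_mapsD)
  with g(1,2) show "\<exists>x\<in>carrier S. \<exists>h\<in>twisted_maps. \<forall>u\<in>carrier S. g u = h u \<otimes> x"
    by blast
qed

lemma twisted_group_carrierI:
  assumes "x \<in> carrier S" "h \<in> twisted_maps" "g \<in> extensional (carrier S)"
    "\<And>u. u \<in> carrier S \<Longrightarrow> g u = h u \<otimes> x"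
  shows "g \<in> carrier twisted_group"
proof -
  have "g = compose (carrier S) (rmult x) h"
    using assms twisted_mapsD(3)[OF assms(2)]
    by (intro extensionalityI[of _ "carrier S"]) (auto simp: compose_def rmult_def)
  then show ?thesis
    using assms by (auto simp: twisted_group_def)
qed

lemma twisted_group_simps:
  "f \<otimes>\<^bsub>twisted_group\<^esub> g = compose (carrier S) g f"
  "\<one>\<^bsub>twisted_group\<^esub> = (\<lambda>u\<in>carrier S. u)"
  by (auto simp: twisted_group_def)

lemma twisted_maps_subset: "twisted_maps \<subseteq> carrier twisted_group"
  by (auto intro!: twisted_group_carrierI[of \<one>] simp: twisted_mapsD one_closed r_one)

lemma rmult_closed: "x \<in> carrier S \<Longrightarrow> rmult x \<in> carrier twisted_group"
  by (intro twisted_group_carrierI[OF _ id_in_twisted_maps]) (auto simp: rmult_def)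

lemma twisted_group_apply:
  assumes "g \<in> carrier twisted_group" "u \<in> carrier S"
  shows "g u \<in> carrier S"
  using twisted_group_carrierD(2)[OF assms(1)] assms(2) by (auto simp: m_closed twisted_mapsD)

text \<open>
  Pushing \<open>k\<close> past a right multiplication by \<open>x \<noteq> 1\<close> replaces \<open>k\<close> by its conjugate, and the two
  right multiplications then merge at the cost of an inner map. The case \<open>x = 1\<close> is separate
  because the law of a twisted automorphism is silent about it.
\<close>

lemma twisted_group_mult_closed:
  assumes "f \<in> carrier twisted_group" "g \<in> carrier twisted_group"
  shows "compose (carrier S) g f \<in> carrier twisted_group"
proof -
  obtain x h where f: "x \<in> carrier S" "h \<in> twisted_maps"
      "\<forall>u\<in>carrier S. f u = h u \<otimes> x"
    using twisted_group_carrierD(2)[OF assms(1)] by blast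
  obtain y k where g: "y \<in> carrier S" "k \<in> twisted_maps"
      "\<forall>u\<in>carrier S. g u = k u \<otimes> y"
    using twisted_group_carrierD(2)[OF assms(2)] by blast
  note closed = m_closed twisted_mapsD(3)[OF f(2)] twisted_mapsD(3)[OF g(2)]
    twisted_mapsD(3)[OF conj_in_twisted_maps[OF g(2)]]
  show ?thesis
  proof (cases "x = \<one>")
    case True
    have "compose (carrier S) k h \<in> twisted_maps"
      using f g by (intro compose_in_twisted_maps)
    then show ?thesis
      by (rule twisted_group_carrierI[OF g(1)])
         (auto simp: compose_eq f g closed True r_one)
  next
    case False
    let ?i = "restrict (right_inner_map S (k x) y) (carrier S)"
    have "?i \<in> twisted_maps"
      using f g closed by (intro right_inner_map_in_twisted_maps)
    then have h': "compose (carrier S) ?i (compose (carrier S) (conj_left_inv k) h) \<in> twisted_maps"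
      using f g by (intro compose_in_twisted_maps conj_in_twisted_maps)
    have "g (f u) = ?i (conj_left_inv k (h u)) \<otimes> (k x \<otimes> y)" if u: "u \<in> carrier S" for u
    proof -
      have "g (f u) = (conj_left_inv k (h u) \<otimes> k x) \<otimes> y"
        using f g u False closed twisted_mult[OF twisted_mapsD(1)[OF g(2)], of "h u" x] by simp
      then show ?thesis
        using closed(4)[OF closed(2)[OF u]] f g closed
        by (simp add: right_inner_map_mult del: restrict_apply)
           (simp add: right_inner_map_mult)
    qed
    then show ?thesis
      by (intro twisted_group_carrierI[OF _ h'])
         (use f g closed in \<open>auto simp: compose_eq simp del: restrict_apply\<close>)
  qed
qed

text \<open>
  By the right inverse property \<open>v = h u x\<close> is solved by \<open>u = h\<^sup>-\<^sup>1(v x')\<close>.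
\<close>

lemma twisted_group_ex_left_inverse:
  assumes "f \<in> carrier twisted_group"
  shows "\<exists>g\<in>carrier twisted_group. compose (carrier S) f g = (\<lambda>u\<in>carrier S. u)"
proof -
  obtain x h where f: "x \<in> carrier S" "h \<in> twisted_maps"
      "\<forall>u\<in>carrier S. f u = h u \<otimes> x"
    using twisted_group_carrierD(2)[OF assms] by blast
  obtain k where k: "k \<in> twisted_maps" "\<And>u. u \<in> carrier S \<Longrightarrow> h (k u) = u"
    using ex_inverse_in_twisted_maps[OF f(2)] by blast
  let ?g = "compose (carrier S) k (rmult (left_inv S x))"
  have g: "?g \<in> carrier twisted_group"
    using f k twisted_maps_subset
    by (intro twisted_group_mult_closed rmult_closed) (auto simp: left_inv_closed)
  have "compose (carrier S) f ?g = (\<lambda>u\<in>carrier S. u)"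
    using f k
    by (auto simp: fun_eq_iff compose_def rmult_def m_closed left_inv_closed twisted_mapsD
        right_inverse_property')
  with g show ?thesis by blast
qed

lemma twisted_group: "group twisted_group"
proof (rule groupI)
  fix f g k
  assume fgk: "f \<in> carrier twisted_group" "g \<in> carrier twisted_group" "k \<in> carrier twisted_group"
  show "f \<otimes>\<^bsub>twisted_group\<^esub> g \<otimes>\<^bsub>twisted_group\<^esub> k = f \<otimes>\<^bsub>twisted_group\<^esub> (g \<otimes>\<^bsub>twisted_group\<^esub> k)"
    using twisted_group_apply[OF fgk(1)]
    by (auto simp: twisted_group_simps compose_def fun_eq_iff)
next
  fix f assume f: "f \<in> carrier twisted_group"
  then have "f \<in> extensional (carrier S)"
    by (rule twisted_group_carrierD(1))
  then show "\<one>\<^bsub>twisted_group\<^esub> \<otimes>\<^bsub>twisted_group\<^esub> f = f"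
    by (auto simp: twisted_group_simps compose_def fun_eq_iff extensional_def)
next
  show "\<one>\<^bsub>twisted_group\<^esub> \<in> carrier twisted_group"
    using id_in_twisted_maps twisted_maps_subset by (auto simp: twisted_group_simps)
qed (auto simp: twisted_group_simps twisted_group_mult_closed twisted_group_ex_left_inverse)

lemma twisted_maps_subgroup: "subgroup twisted_maps twisted_group"
proof -
  interpret G: group twisted_group by (rule twisted_group)
  show ?thesis
  proof (rule G.subgroupI)
    fix h assume h: "h \<in> twisted_maps"
    obtain k where k: "k \<in> twisted_maps" "\<And>u. u \<in> carrier S \<Longrightarrow> h (k u) = u"
      using ex_inverse_in_twisted_maps[OF h] by blast
    then have "k \<otimes>\<^bsub>twisted_group\<^esub> h = \<one>\<^bsub>twisted_group\<^esub>"
      by (auto simp: twisted_group_simps compose_def fun_eq_iff)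
    then have "inv\<^bsub>twisted_group\<^esub> h = k"
      using h k twisted_maps_subset by (intro G.inv_equality) auto
    with k show "inv\<^bsub>twisted_group\<^esub> h \<in> twisted_maps" by simp
  qed (use twisted_maps_subset id_in_twisted_maps in
        \<open>auto simp: twisted_group_simps compose_in_twisted_maps\<close>)
qed

lemma rmult_apply_one: "x \<in> carrier S \<Longrightarrow> rmult x \<one> = x"
  by (simp add: rmult_def one_closed l_one)

lemma rmult_inj: "inj_on rmult (carrier S)"
  by (rule inj_on_inverseI[of _ "\<lambda>f. f \<one>"]) (rule rmult_apply_one)

lemma inv_rmult:
  assumes "x \<in> carrier S"
  shows "inv\<^bsub>twisted_group\<^esub> (rmult x) = rmult (left_inv S x)"
proof -
  interpret G: group twisted_group by (rule twisted_group)
  have "rmult (left_inv S x) \<otimes>\<^bsub>twisted_group\<^esub> rmult x = \<one>\<^bsub>twisted_group\<^esub>"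
    using assms
    by (intro extensionalityI[of _ "carrier S"])
       (auto simp: twisted_group_simps compose_eq rmult_def m_closed left_inv_closed
         right_inverse_property')
  then show ?thesis
    using assms by (intro G.inv_equality) (auto simp: rmult_closed left_inv_closed)
qed

text \<open>
  Every map in the coset of \<open>h R\<^sub>x\<close> sends \<open>1\<close> to \<open>x\<close>, since twisted automorphisms fix \<open>1\<close>;
  so evaluation at \<open>1\<close> singles out \<open>R\<^sub>x\<close> among the right multiplications.
\<close>

lemma rmult_right_transversal: "right_transversal twisted_group twisted_maps (rmult ` carrier S)"
  unfolding right_transversal_def
proof (intro conjI ballI)
  show "rmult ` carrier S \<subseteq> carrier twisted_group"
    using rmult_closed by auto
  show "\<one>\<^bsub>twisted_group\<^esub> \<in> rmult ` carrier S"
    using one_closed rmult_one by (auto simp: twisted_group_simps intro: rev_image_eqI)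
next
  interpret G: group twisted_group by (rule twisted_group)
  fix C assume "C \<in> rcosets\<^bsub>twisted_group\<^esub> twisted_maps"
  then obtain g where g: "g \<in> carrier twisted_group" "C = twisted_maps #>\<^bsub>twisted_group\<^esub> g"
    by (auto simp: RCOSETS_def)
  then obtain x h where x: "x \<in> carrier S" "h \<in> twisted_maps"
      "g = h \<otimes>\<^bsub>twisted_group\<^esub> rmult x"
    by (auto simp: twisted_group_def)
  have "h \<in> carrier twisted_group"
    using x twisted_maps_subset by auto
  then have "rmult x = inv\<^bsub>twisted_group\<^esub> h \<otimes>\<^bsub>twisted_group\<^esub> g"
    using x g by (simp add: rmult_closed G.inv_solve_left)
  then have "rmult x \<in> C"
    using g(2) x subgroup.m_inv_closed[OF twisted_maps_subgroup] by (auto simp: r_coset_def)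
  then have "rmult x \<in> rmult ` carrier S \<inter> C"
    using x(1) by simp
  moreover have "t = rmult x" if t: "t \<in> rmult ` carrier S \<inter> C" for t
  proof -
    obtain y k where y: "y \<in> carrier S" "t = rmult y" "k \<in> twisted_maps"
        "t = k \<otimes>\<^bsub>twisted_group\<^esub> g"
      using t g(2) by (auto simp: r_coset_def)
    have "y = rmult y \<one>"
      using y by (simp add: rmult_apply_one)
    also have "\<dots> = (k \<otimes>\<^bsub>twisted_group\<^esub> g) \<one>"
      using y by simp
    also have "\<dots> = x"
      using x y(3)
      by (simp add: twisted_group_simps compose_eq one_closed rmult_def l_one
          twisted_one twisted_mapsD)
    finally show ?thesis
      using y by simp
  qed
  ultimately show "\<exists>!t. t \<in> rmult ` carrier S \<inter> C"
    by (rule ex1I)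
qed

lemma conj_iso:
  "conj_left_inv \<in>
    iso (twisted_group\<lparr>carrier := twisted_maps\<rparr>) (twisted_group\<lparr>carrier := twisted_maps\<rparr>)"
proof -
  have "bij_betw conj_left_inv twisted_maps twisted_maps"
    using conj_in_twisted_maps conj_conj_eq
    by (intro bij_betw_byWitness[of _ conj_left_inv]) auto
  then show ?thesis
    using conj_in_twisted_maps
    by (auto simp: iso_def hom_def twisted_group_simps conj_compose twisted_mapsD)
qed

lemma rmult_twist:
  assumes "x \<in> carrier S" "x \<noteq> \<one>" "h \<in> twisted_maps"
  shows "inv\<^bsub>twisted_group\<^esub> (conj_left_inv h) \<otimes>\<^bsub>twisted_group\<^esub> rmult x \<otimes>\<^bsub>twisted_group\<^esub> h = rmult (h x)"
proof -
  interpret G: group twisted_group by (rule twisted_group)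
  have c: "h \<in> carrier twisted_group" "conj_left_inv h \<in> carrier twisted_group"
      "rmult x \<in> carrier twisted_group" "rmult (h x) \<in> carrier twisted_group"
    using assms twisted_maps_subset conj_in_twisted_maps[OF assms(3)]
    by (auto simp: rmult_closed twisted_mapsD)
  have "rmult x \<otimes>\<^bsub>twisted_group\<^esub> h = conj_left_inv h \<otimes>\<^bsub>twisted_group\<^esub> rmult (h x)"
  proof (rule extensionalityI[of _ "carrier S"])
    fix u assume u: "u \<in> carrier S"
    have "conj_left_inv h u \<in> carrier S"
      using twisted_mapsD(3)[OF conj_in_twisted_maps[OF assms(3)] u] .
    then show "(rmult x \<otimes>\<^bsub>twisted_group\<^esub> h) u =
        (conj_left_inv h \<otimes>\<^bsub>twisted_group\<^esub> rmult (h x)) u"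
      using u twisted_mult[OF twisted_mapsD(1)[OF assms(3)] u assms(1,2)]
      by (simp add: twisted_group_simps compose_eq rmult_def)
  qed (auto simp: twisted_group_simps)
  then show ?thesis
    using c by (simp add: G.m_assoc G.inv_solve_left' del: restrict_apply)
qed

lemma appears_in_twisted_group:
  "appears_as_twisted_gyrotransversal S twisted_group twisted_maps rmult"
  unfolding appears_as_twisted_gyrotransversal_def twisted_gyrotransversal_def
proof (intro conjI twisted_group twisted_maps_subgroup rmult_inj rmult_right_transversal
    bexI[OF _ conj_iso] ballI)
  fix t assume "t \<in> rmult ` carrier S"
  then show "inv\<^bsub>twisted_group\<^esub> t \<in> rmult ` carrier S"
    by (auto simp: inv_rmult left_inv_closed)
next
  fix h assume "h \<in> twisted_maps"
  then show "conj_left_inv (conj_left_inv h) = h"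
    by (rule conj_conj_eq)
next
  fix t h assume "t \<in> rmult ` carrier S - {\<one>\<^bsub>twisted_group\<^esub>}" and h: "h \<in> twisted_maps"
  then obtain x where "x \<in> carrier S" "t = rmult x" "rmult x \<noteq> rmult \<one>"
    by (auto simp: twisted_group_simps rmult_one)
  moreover from this have "x \<noteq> \<one>"
    by blast
  ultimately show "inv\<^bsub>twisted_group\<^esub> (conj_left_inv h) \<otimes>\<^bsub>twisted_group\<^esub> t \<otimes>\<^bsub>twisted_group\<^esub> h \<in> rmult ` carrier S"
    using rmult_twist h twisted_mapsD(3) by auto
next
  fix x y assume xy: "x \<in> carrier S" "y \<in> carrier S"
  let ?i = "restrict (right_inner_map S x y) (carrier S)"
  have "rmult x \<otimes>\<^bsub>twisted_group\<^esub> rmult y = ?i \<otimes>\<^bsub>twisted_group\<^esub> rmult (x \<otimes> y)"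
    using xy
    by (intro extensionalityI[of _ "carrier S"])
       (auto simp: twisted_group_simps compose_eq rmult_def m_closed right_inner_map)
  then show "rmult x \<otimes>\<^bsub>twisted_group\<^esub> rmult y \<in> twisted_maps #>\<^bsub>twisted_group\<^esub> rmult (x \<otimes> y)"
    using right_inner_map_in_twisted_maps[OF xy] by (auto simp: r_coset_def)
qed

end

section \<open>The characterization\<close>

theorem theorem4p9:
  fixes S :: "('a, 'b) monoid_scheme"
  assumes "right_loop S"
  shows "(twisted_right_gyrogroup S \<longleftrightarrow>
            (\<exists>(G :: ('a \<Rightarrow> 'a) monoid) H j. appears_as_twisted_gyrotransversal S G H j))
       \<and> (\<forall>(G :: ('g, 'm) monoid_scheme) H j.
            appears_as_twisted_gyrotransversal S G H j \<longrightarrow> twisted_right_gyrogroup S)"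
  by (blast intro: twisted_right_gyrogroup_if_appears[OF assms]
      twisted_right_gyrogroup.appears_in_twisted_group)

end
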